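(* Let $X$ be a metric space with metric $d$ and let $T:X\to X$ be a measurable map. Then $T$ expands small distances if and only if every Borel probability measure $\mu$ of $X$ has positive expansion exponent with respect to $T$, i.e. $E_\mu(T)>0$.
   Context: A map $T:X\to X$ of a metric space is measurable if the preimage under $T$ of every Borel set is a Borel set. A Borel probability measure of $X$ is a $\sigma$-additive measure $\mu$ on the Borel $\sigma$-algebra of $X$ with $\mu(X)=1$. $B(x,\epsilon)$ denotes the open ball of radius $\epsilon$ centered at $x$. $T$ expands small distances if there are $k>1$ and $\epsilon>0$ such that $d(T(x),T(y))\geq k\,d(x,y)$ for all $x\in X$ and all $y\in B(x,\epsilon)$. For a Borel probability measure $\mu$, the expansion exponent of $\mu$ with respect to $T$ is $$E_\mu(T)=\sup\{\lambda\in\mathbb{R}\mid \exists\,\epsilon>0 \text{ such that } \mu(\{y\in B(x,\epsilon)\mid d(T(x),T(y))<e^\lambda d(x,y)\})=0 \text{ for all } x\in X\},$$ with the convention $\sup\emptyset=-\infty$ (the value lies in $[-\infty,+\infty]$). *)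

theory Defs
  imports "HOL-Probability.Probability"
begin

definition expands_small_distances :: "('a::metric_space \<Rightarrow> 'a) \<Rightarrow> bool" where
  "expands_small_distances T \<longleftrightarrow>
     (\<exists>k::real. \<exists>\<epsilon>::real. k > 1 \<and> \<epsilon> > 0 \<and>
        (\<forall>x. \<forall>y\<in>ball x \<epsilon>. dist (T x) (T y) \<ge> k * dist x y))"

definition borel_prob_measure :: "'a::metric_space measure \<Rightarrow> bool" where
  "borel_prob_measure \<mu> \<longleftrightarrow> prob_space \<mu> \<and> sets \<mu> = sets borel"

(* The set inside emeasure is Borel whenever T is Borel measurable, since x is fixed
   and y \<mapsto> dist (T x) (T y) is then a measurable real function; so the value 0 that
   emeasure assigns to non-measurable sets plays no role.
   In ereal, Sup {} = -\<infinity>, which is the intended convention. *)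
definition expansion_exponent :: "'a::metric_space measure \<Rightarrow> ('a \<Rightarrow> 'a) \<Rightarrow> ereal" where
  "expansion_exponent \<mu> T =
     Sup (ereal ` {l::real. \<exists>\<epsilon>::real. \<epsilon> > 0 \<and>
       (\<forall>x. emeasure \<mu> {y \<in> ball x \<epsilon>. dist (T x) (T y) < exp l * dist x y} = 0)})"

end

theory Submission
  imports Defs
begin

text \<open>
  If \<open>T\<close> stretches all distances below \<open>\<epsilon>\<close> by a factor \<open>k > 1\<close>, then \<open>\<lambda> = ln k\<close> is
  admissible in the supremum for every measure at once, because the exceptional sets are empty.

  Conversely, if \<open>T\<close> fails to expand, then the failure at the scales \<open>\<epsilon> = 1/(n+1)\<close>,
  \<open>k = 1 + 1/(n+1)\<close> is witnessed by countably many pairs \<open>(x\<^sub>n, y\<^sub>n)\<close> only, and a single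
  measure can see them all: a convex combination, with positive weights, of the point masses
  at the \<open>y\<^sub>n\<close>. For any \<open>\<lambda> > 0\<close> and any \<open>\<epsilon> > 0\<close>, a sufficiently large \<open>n\<close> puts the atom
  \<open>y\<^sub>n\<close> into the exceptional set around \<open>x\<^sub>n\<close>, so no positive \<open>\<lambda>\<close> is admissible and
  the exponent of this measure is at most \<open>0\<close>.
\<close>

lemma expands_imp_exponent_pos:
  assumes "expands_small_distances T"
  shows "expansion_exponent \<mu> T > 0"
proof -
  obtain k \<epsilon> :: real where k: "k > 1" and \<epsilon>: "\<epsilon> > 0"
    and expand: "\<And>x y. y \<in> ball x \<epsilon> \<Longrightarrow> dist (T x) (T y) \<ge> k * dist x y"
    using assms unfolding expands_small_distances_def by blast
  have "{y \<in> ball x \<epsilon>. dist (T x) (T y) < exp (ln k) * dist x y} = {}" for x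
    using expand[of _ x] k by (force simp: not_less)
  then have "\<forall>x. emeasure \<mu> {y \<in> ball x \<epsilon>. dist (T x) (T y) < exp (ln k) * dist x y} = 0"
    by (simp only: emeasure_empty) simp
  then have "ereal (ln k) \<le> expansion_exponent \<mu> T"
    unfolding expansion_exponent_def using \<epsilon> by (intro Sup_upper) blast
  moreover have "0 < ereal (ln k)"
    using k by simp
  ultimately show ?thesis
    by (rule less_le_trans[rotated])
qed

text \<open>
  Measurability of \<open>T\<close> enters only here. Since the centre \<open>x\<close> is fixed, no measurability of
  \<open>dist\<close> on the product \<open>\<sigma>\<close>-algebra is involved, which could fail without separability.
\<close>

lemma exceptional_set_borel:
  fixes T :: "'a::metric_space \<Rightarrow> 'a"
  assumes [measurable]: "T \<in> measurable borel borel"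
  shows "{y \<in> ball x \<epsilon>. dist (T x) (T y) < c * dist x y} \<in> sets borel"
proof -
  have [measurable]: "dist z \<in> borel_measurable borel" for z :: 'a
    by (intro borel_measurable_continuous_onI continuous_intros)
  have "{y \<in> space borel. dist x y < \<epsilon> \<and> dist (T x) (T y) < c * dist x y} \<in> sets borel"
    by measurable
  then show ?thesis
    by simp
qed

text \<open>
  Pushing a fully supported distribution on \<^typ>\<open>nat\<close> forward along a sequence yields the
  convex combination of its point masses; the geometric distribution is one such choice.
\<close>

lemma ex_prob_measure_charging_sequence:
  fixes y :: "nat \<Rightarrow> 'a::metric_space"
  obtains \<mu> where "borel_prob_measure \<mu>"
    "\<And>A n. A \<in> sets borel \<Longrightarrow> y n \<in> A \<Longrightarrow> emeasure \<mu> A \<noteq> 0"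
proof
  define p where "p = geometric_pmf (1/2)"
  show "borel_prob_measure (distr (measure_pmf p) borel y)"
    unfolding borel_prob_measure_def by (auto intro: measure_pmf.prob_space_distr)
  fix A n
  assume A: "A \<in> sets borel" "y n \<in> A"
  have "n \<in> set_pmf p"
    by (simp add: p_def set_pmf_geometric)
  with A(2) have "set_pmf p \<inter> y -` A \<noteq> {}"
    by blast
  with A(1) show "emeasure (distr (measure_pmf p) borel y) A \<noteq> 0"
    by (auto simp: emeasure_distr measure_pmf.emeasure_eq_measure measure_pmf_zero_iff)
qed

lemma exponent_pos_imp_expands:
  fixes T :: "'a::metric_space \<Rightarrow> 'a"
  assumes meas: "T \<in> measurable borel borel"
    and pos: "\<And>\<mu> :: 'a measure. borel_prob_measure \<mu> \<Longrightarrow> expansion_exponent \<mu> T > 0"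
  shows "expands_small_distances T"
proof (rule ccontr)
  assume not_expands: "\<not> expands_small_distances T"
  define e where "e n = 1 / real (Suc n)" for n
  have "\<exists>x. \<exists>y \<in> ball x (e n). dist (T x) (T y) < (1 + e n) * dist x y" for n
  proof -
    have "1 + e n > 1" "e n > 0"
      by (simp_all add: e_def)
    with not_expands show ?thesis
      unfolding expands_small_distances_def not_le[symmetric] by blast
  qed
  then obtain x y where near: "\<And>n. y n \<in> ball (x n) (e n)"
    and contract: "\<And>n. dist (T (x n)) (T (y n)) < (1 + e n) * dist (x n) (y n)"
    by metis
  obtain \<mu> where \<mu>: "borel_prob_measure \<mu>"
    and charge: "\<And>A n. A \<in> sets borel \<Longrightarrow> y n \<in> A \<Longrightarrow> emeasure \<mu> A \<noteq> 0"
    using ex_prob_measure_charging_sequence[of y] by blast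
  obtain l \<epsilon> :: real where l: "l > 0" and \<epsilon>: "\<epsilon> > 0" and
    null: "\<And>x. emeasure \<mu> {y \<in> ball x \<epsilon>. dist (T x) (T y) < exp l * dist x y} = 0"
    using pos[OF \<mu>] unfolding expansion_exponent_def less_Sup_iff by auto
  have "min \<epsilon> l > 0"
    using l \<epsilon> by simp
  then obtain n where "e n < min \<epsilon> l"
    unfolding e_def using nat_approx_posE by blast
  then have n: "e n < \<epsilon>" "e n < l"
    by simp_all
  then have "1 + e n \<le> exp l"
    using exp_ge_add_one_self[of l] by linarith
  then have "(1 + e n) * dist (x n) (y n) \<le> exp l * dist (x n) (y n)"
    by (intro mult_right_mono) auto
  then have "y n \<in> {y \<in> ball (x n) \<epsilon>. dist (T (x n)) (T y) < exp l * dist (x n) y}"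
    using near[of n] contract[of n] n(1) by auto
  then show False
    using charge[OF exceptional_set_borel[OF meas]] null[of "x n"] by simp
qed

theorem mainTheorem2:
  fixes T :: "'a::metric_space \<Rightarrow> 'a"
  assumes "T \<in> measurable borel borel"
  shows "expands_small_distances T \<longleftrightarrow>
    (\<forall>\<mu> :: 'a measure. borel_prob_measure \<mu> \<longrightarrow> expansion_exponent \<mu> T > 0)"
  using expands_imp_exponent_pos exponent_pos_imp_expands[OF assms] by blast

end
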